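(* A generic compact metric space is totally anisometric: the set of totally anisometric spaces $X\in\mathfrak{M}$ is a residual subset of the Gromov-Hausdorff space $(\mathfrak{M},d_{GH})$.
   Context: $\mathfrak{M}$ denotes the Gromov-Hausdorff space: the set of all nonempty compact metric spaces up to isometry, endowed with the Gromov-Hausdorff distance $d_{GH}(X,Y)=\inf d_H^Z(f(X),g(Y))$, where the infimum is over all metric spaces $Z$ and all isometric injections $f:X\to Z$, $g:Y\to Z$, and $d_H^Z$ is the Hausdorff distance between subsets of $Z$. The metric space $\mathfrak{M}$ is complete, hence a Baire space. A subset is rare if its closure has empty interior, meager if it is a countable union of rare sets, and residual if its complement is meager. "A generic compact metric space has property $P$" means that the set of $X\in\mathfrak{M}$ having $P$ is residual in $\mathfrak{M}$. A metric space $X$ is totally anisometric if two distinct pairs of points have distinct distances, i.e. whenever $x,y,x',y'\in X$ satisfy $d(x,y)=d(x',y')>0$, one has $\{x,y\}=\{x',y'\}$. *)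

theory Defs
  imports "HOL-Analysis.Analysis"
begin

section \<open>Rare, meager and residual sets\<close>

definition rare :: "'a::topological_space set \<Rightarrow> bool"
  where "rare S \<longleftrightarrow> interior (closure S) = {}"

definition meager :: "'a::topological_space set \<Rightarrow> bool"
  where "meager S \<longleftrightarrow> (\<exists>F. countable F \<and> (\<forall>A\<in>F. rare A) \<and> S = \<Union>F)"

definition residual :: "'a::topological_space set \<Rightarrow> bool"
  where "residual S \<longleftrightarrow> meager (- S)"


section \<open>Metric spaces as objects\<close>

definition compact_metric :: "'a metric \<Rightarrow> bool"
  where "compact_metric X \<longleftrightarrow> mspace X \<noteq> {} \<and> compact_space (mtopology_of X)"

definition isometric_embedding :: "'a metric \<Rightarrow> 'b metric \<Rightarrow> ('a \<Rightarrow> 'b) \<Rightarrow> bool"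
  where "isometric_embedding X Y f \<longleftrightarrow>
    f \<in> mspace X \<rightarrow> mspace Y \<and>
    (\<forall>x\<in>mspace X. \<forall>x'\<in>mspace X. mdist Y (f x) (f x') = mdist X x x')"

definition isometric :: "'a metric \<Rightarrow> 'b metric \<Rightarrow> bool"
  where "isometric X Y \<longleftrightarrow> (\<exists>f. isometric_embedding X Y f \<and> f ` mspace X = mspace Y)"

definition totally_anisometric :: "'a metric \<Rightarrow> bool"
  where "totally_anisometric X \<longleftrightarrow>
    (\<forall>x\<in>mspace X. \<forall>y\<in>mspace X. \<forall>x'\<in>mspace X. \<forall>y'\<in>mspace X.
       mdist X x y = mdist X x' y' \<and> mdist X x y > 0 \<longrightarrow> {x, y} = {x', y'})"

definition hausdorff_dist :: "'a metric \<Rightarrow> 'a set \<Rightarrow> 'a set \<Rightarrow> real"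
  where "hausdorff_dist Z A B =
    Inf {r. 0 \<le> r \<and> (\<forall>a\<in>A. \<exists>b\<in>B. mdist Z a b \<le> r) \<and> (\<forall>b\<in>B. \<exists>a\<in>A. mdist Z a b \<le> r)}"

text \<open>
  HOL cannot quantify over all types inside a definition, so the ambient spaces \<open>Z\<close> range over
  all metric spaces whose points are taken from the type \<open>nat \<Rightarrow> real\<close>.
  No generality is lost, see \<open>gh_distance_le\<close> (ambient spaces of arbitrary type) and
  \<open>compact_metric_representable\<close> (compact metric spaces of arbitrary type) below.
\<close>

type_synonym point = "nat \<Rightarrow> real"

definition gh_distance :: "'a metric \<Rightarrow> 'b metric \<Rightarrow> real"
  where "gh_distance X Y =
    Inf {hausdorff_dist Z (f ` mspace X) (g ` mspace Y) | (Z :: point metric) f g.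
           isometric_embedding X Z f \<and> isometric_embedding Y Z g}"


section \<open>Isometries\<close>

lemma mdist_refl: "x \<in> mspace X \<Longrightarrow> mdist X x x = 0"
  by simp

lemma isometric_refl: "isometric X X"
  unfolding isometric_def isometric_embedding_def by (intro exI[of _ id]) auto

lemma isometric_sym:
  assumes "isometric X Y" shows "isometric Y X"
proof -
  obtain f where f: "f ` mspace X = mspace Y"
    and d: "\<And>x x'. x \<in> mspace X \<Longrightarrow> x' \<in> mspace X \<Longrightarrow> mdist Y (f x) (f x') = mdist X x x'"
    using assms by (auto simp: isometric_def isometric_embedding_def)
  define g where "g = inv_into (mspace X) f"
  have g: "g y \<in> mspace X" "f (g y) = y" if "y \<in> mspace Y" for y
    using that f by (simp_all add: g_def inv_into_into f_inv_into_f)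
  have "inj_on f (mspace X)"
    by (metis d inj_onI f imageI mdist_zero)
  then have "g (f x) = x" if "x \<in> mspace X" for x
    using that by (simp add: g_def)
  then have "g ` mspace Y = mspace X"
    using f g by force
  moreover have "isometric_embedding Y X g"
    unfolding isometric_embedding_def using g d by (metis Pi_I)
  ultimately show ?thesis
    unfolding isometric_def by blast
qed

lemma isometric_trans:
  assumes "isometric X Y" "isometric Y Z" shows "isometric X Z"
proof -
  obtain f g where "isometric_embedding X Y f" "f ` mspace X = mspace Y"
    "isometric_embedding Y Z g" "g ` mspace Y = mspace Z"
    using assms by (auto simp: isometric_def)
  then have "isometric_embedding X Z (g \<circ> f)" "(g \<circ> f) ` mspace X = mspace Z"
    by (auto simp: isometric_embedding_def Pi_iff simp flip: image_image)
  then show ?thesis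
    unfolding isometric_def by blast
qed

lemma totally_anisometric_isometric_imp:
  assumes "isometric X Y" "totally_anisometric Y" shows "totally_anisometric X"
proof -
  obtain f where f: "f \<in> mspace X \<rightarrow> mspace Y"
    and d: "\<And>x x'. x \<in> mspace X \<Longrightarrow> x' \<in> mspace X \<Longrightarrow> mdist Y (f x) (f x') = mdist X x x'"
    using assms by (auto simp: isometric_def isometric_embedding_def)
  have inj: "f x = f x' \<longleftrightarrow> x = x'" if "x \<in> mspace X" "x' \<in> mspace X" for x x'
    by (metis that d f mdist_zero PiE)
  show ?thesis
    unfolding totally_anisometric_def
  proof (intro ballI impI)
    fix x y x' y'
    assume *: "x \<in> mspace X" "y \<in> mspace X" "x' \<in> mspace X" "y' \<in> mspace X"
      and "mdist X x y = mdist X x' y' \<and> mdist X x y > 0"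
    then have "mdist Y (f x) (f y) = mdist Y (f x') (f y') \<and> mdist Y (f x) (f y) > 0"
      using d by auto
    moreover have "f x \<in> mspace Y" "f y \<in> mspace Y" "f x' \<in> mspace Y" "f y' \<in> mspace Y"
      using * f by auto
    ultimately have "{f x, f y} = {f x', f y'}"
      using assms(2) unfolding totally_anisometric_def by blast
    then show "{x, y} = {x', y'}"
      using * inj by (auto simp: doubleton_eq_iff)
  qed
qed

lemma compact_metric_bounded:
  assumes "compact_metric X"
  obtains D where "0 \<le> D" "\<And>x x'. x \<in> mspace X \<Longrightarrow> x' \<in> mspace X \<Longrightarrow> mdist X x x' \<le> D"
proof -
  interpret Metric_space "mspace X" "mdist X" by blast
  have "mbounded (mspace X)"
    using assms compactin_imp_mbounded
    by (simp add: compact_metric_def compact_space_def mtopology_of_def)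
  then obtain B where B: "\<forall>x\<in>mspace X. \<forall>y\<in>mspace X. mdist X x y \<le> B"
    unfolding mbounded_alt by blast
  show thesis
    by (rule that[of "max 0 B"]) (use B in \<open>auto intro: max.coboundedI2\<close>)
qed

lemma metric_transport:
  fixes X :: "'a metric" and h :: "'a \<Rightarrow> 'b"
  assumes "inj_on h (mspace X)"
  obtains Y :: "'b metric" where "mspace Y = h ` mspace X" "isometric_embedding X Y h"
proof -
  let ?k = "inv_into (mspace X) h"
  let ?d = "\<lambda>x y. mdist X (?k x) (?k y)"
  have k: "?k (h x) = x" if "x \<in> mspace X" for x
    using that assms by simp
  interpret Metric_space "h ` mspace X" ?d
    by unfold_locales (auto simp: k mdist_commute mdist_triangle)
  show thesis
    by (rule that[of "metric (h ` mspace X, ?d)"]) (auto simp: isometric_embedding_def k)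
qed

theorem compact_metric_representable:
  fixes X :: "'a metric"
  assumes "compact_metric X"
  obtains Y :: "point metric" where "isometric X Y" "compact_metric Y"
proof -
  interpret Metric_space "mspace X" "mdist X" by blast
  have cpt: "compact_space mtopology"
    using assms by (simp add: compact_metric_def mtopology_of_def)
  then have tb: "mtotally_bounded (mspace X)"
    by (simp add: compact_space_eq_mcomplete_mtotally_bounded)
  have "\<exists>K. finite K \<and> K \<subseteq> mspace X \<and> mspace X \<subseteq> (\<Union>x\<in>K. mball x (1 / Suc n))" for n
    using tb unfolding mtotally_bounded_def by simp
  then obtain K where K: "\<And>n. finite (K n)" "\<And>n. K n \<subseteq> mspace X"
    "\<And>n. mspace X \<subseteq> (\<Union>x\<in>K n. mball x (1 / Suc n))"
    by metis
  define D where "D = (\<Union>n. K n)"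
  have "countable D"
    unfolding D_def using K(1) by (intro countable_UN) (auto intro: countable_finite)
  moreover have "D \<subseteq> mspace X"
    unfolding D_def using K(2) by blast
  ultimately have D: "countable D" "D \<subseteq> mspace X" .
  have dense: "\<exists>a\<in>D. mdist X a x < e" if "x \<in> mspace X" "e > 0" for x e
  proof -
    obtain n where n: "1 / real (Suc n) < e"
      using \<open>e > 0\<close> nat_approx_posE by auto
    have "x \<in> (\<Union>a\<in>K n. mball a (1 / Suc n))"
      using K(3)[of n] that(1) by (rule subsetD)
    then obtain a where "a \<in> K n" "mdist X a x < 1 / Suc n"
      by auto
    then show ?thesis
      using n unfolding D_def by (meson UN_I UNIV_I less_trans)
  qed
  have "D \<noteq> {}"
    using dense assms by (metis all_not_in_conv compact_metric_def zero_less_one)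
  then have rng: "range (from_nat_into D) = D"
    using D(1) by (rule range_from_nat_into)
  define h where "h x n = mdist X (from_nat_into D n) x" for x n
  have h: "inj_on h (mspace X)"
  proof (rule inj_onI, rule ccontr)
    fix x y assume xy: "x \<in> mspace X" "y \<in> mspace X" "h x = h y" "x \<noteq> y"
    have "mdist X x y / 2 > 0"
      using mdist_pos_less xy(1,2,4) by simp
    then obtain a where a: "a \<in> D" "mdist X a x < mdist X x y / 2"
      using dense[OF xy(1)] by blast
    obtain n where "a = from_nat_into D n"
      using a(1) rng by (metis rangeE)
    then have "mdist X a x = mdist X a y"
      using fun_cong[OF xy(3), of n] by (simp add: h_def)
    moreover have "mdist X x y \<le> mdist X x a + mdist X a y"
      using a D xy by (intro mdist_triangle) auto
    ultimately show False
      using a by (simp add: mdist_commute)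
  qed
  obtain Y :: "point metric" where Y: "mspace Y = h ` mspace X" "isometric_embedding X Y h"
    using metric_transport[OF h] .
  then have iso: "isometric X Y"
    by (auto simp: isometric_def)
  interpret Y: Metric_space "mspace Y" "mdist Y" by blast
  interpret XY: Metric_space12 "mspace X" "mdist X" "mspace Y" "mdist Y" ..
  have "homeomorphic_map mtopology Y.mtopology h"
    using Y by (intro XY.isometry_imp_homeomorphic_map) (auto simp: isometric_embedding_def)
  then have "compact_space Y.mtopology"
    using cpt homeomorphic_compact_space homeomorphic_map_imp_homeomorphic_space by blast
  then have "compact_metric Y"
    using assms Y by (simp add: compact_metric_def mtopology_of_def)
  with iso show thesis by (rule that)
qed


section \<open>Correspondences\<close>

definition correspondence :: "'a metric \<Rightarrow> 'b metric \<Rightarrow> real \<Rightarrow> ('a \<times> 'b) set \<Rightarrow> bool"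
  where "correspondence X Y r R \<longleftrightarrow>
    R \<subseteq> mspace X \<times> mspace Y \<and> fst ` R = mspace X \<and> snd ` R = mspace Y \<and>
    (\<forall>(x, y)\<in>R. \<forall>(x', y')\<in>R. \<bar>mdist X x x' - mdist Y y y'\<bar> \<le> 2 * r)"

lemma correspondenceD:
  assumes "correspondence X Y r R"
  shows "(x, y) \<in> R \<Longrightarrow> x \<in> mspace X" "(x, y) \<in> R \<Longrightarrow> y \<in> mspace Y"
    and "x \<in> mspace X \<Longrightarrow> \<exists>y. (x, y) \<in> R" "y \<in> mspace Y \<Longrightarrow> \<exists>x. (x, y) \<in> R"
    and "(x, y) \<in> R \<Longrightarrow> (x', y') \<in> R \<Longrightarrow> \<bar>mdist X x x' - mdist Y y y'\<bar> \<le> 2 * r"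
proof -
  have sub: "R \<subseteq> mspace X \<times> mspace Y" and im: "fst ` R = mspace X" "snd ` R = mspace Y"
    and dis: "\<forall>(x, y)\<in>R. \<forall>(x', y')\<in>R. \<bar>mdist X x x' - mdist Y y y'\<bar> \<le> 2 * r"
    using assms unfolding correspondence_def by blast+
  show "(x, y) \<in> R \<Longrightarrow> x \<in> mspace X" "(x, y) \<in> R \<Longrightarrow> y \<in> mspace Y"
    using sub by blast+
  show "x \<in> mspace X \<Longrightarrow> \<exists>y. (x, y) \<in> R" "y \<in> mspace Y \<Longrightarrow> \<exists>x. (x, y) \<in> R"
    unfolding im[symmetric] by auto
  show "(x, y) \<in> R \<Longrightarrow> (x', y') \<in> R \<Longrightarrow> \<bar>mdist X x x' - mdist Y y y'\<bar> \<le> 2 * r"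
    using dis by blast
qed

lemma correspondenceI:
  assumes "\<And>x y. (x, y) \<in> R \<Longrightarrow> x \<in> mspace X \<and> y \<in> mspace Y"
    and "\<And>x. x \<in> mspace X \<Longrightarrow> \<exists>y. (x, y) \<in> R" "\<And>y. y \<in> mspace Y \<Longrightarrow> \<exists>x. (x, y) \<in> R"
    and "\<And>x y x' y'. (x, y) \<in> R \<Longrightarrow> (x', y') \<in> R \<Longrightarrow> \<bar>mdist X x x' - mdist Y y y'\<bar> \<le> 2 * r"
  shows "correspondence X Y r R"
  unfolding correspondence_def
proof (intro conjI)
  show sub: "R \<subseteq> mspace X \<times> mspace Y"
    using assms(1) by auto
  show "fst ` R = mspace X" "snd ` R = mspace Y"
    using assms(2,3) sub by force+
  show "\<forall>(x, y)\<in>R. \<forall>(x', y')\<in>R. \<bar>mdist X x x' - mdist Y y y'\<bar> \<le> 2 * r"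
    using assms(4) by blast
qed

lemma correspondence_converse:
  assumes "correspondence X Y r R" shows "correspondence Y X r (R\<inverse>)"
proof (rule correspondenceI)
  show "\<bar>mdist Y y y' - mdist X x x'\<bar> \<le> 2 * r" if "(y, x) \<in> R\<inverse>" "(y', x') \<in> R\<inverse>" for x y x' y'
    using correspondenceD(5)[OF assms, of x y x' y'] that by (simp add: abs_minus_commute)
qed (use correspondenceD(1-4)[OF assms] in simp_all)

lemma correspondence_comp:
  assumes R: "correspondence X Y r R" and S: "correspondence Y Z s S"
  shows "correspondence X Z (r + s) (R O S)"
proof (rule correspondenceI)
  fix x z x' z' assume "(x, z) \<in> R O S" "(x', z') \<in> R O S"
  then obtain y y' where *: "(x, y) \<in> R" "(y, z) \<in> S" "(x', y') \<in> R" "(y', z') \<in> S"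
    by auto
  show "\<bar>mdist X x x' - mdist Z z z'\<bar> \<le> 2 * (r + s)"
    using correspondenceD(5)[OF R *(1,3)] correspondenceD(5)[OF S *(2,4)] by (simp add: abs_le_iff)
next
  show "x \<in> mspace X \<and> z \<in> mspace Z" if "(x, z) \<in> R O S" for x z
    using that correspondenceD(1)[OF R] correspondenceD(2)[OF S] by blast
  show "\<exists>z. (x, z) \<in> R O S" if "x \<in> mspace X" for x
    using correspondenceD(3)[OF R that] correspondenceD(2)[OF R] correspondenceD(3)[OF S] by blast
  show "\<exists>x. (x, z) \<in> R O S" if "z \<in> mspace Z" for z
    using correspondenceD(4)[OF S that] correspondenceD(1)[OF S] correspondenceD(4)[OF R] by blast
qed

lemma correspondence_of_embeddings:
  assumes f: "isometric_embedding X Z f" and g: "isometric_embedding Y Z g"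
    and 1: "\<forall>a\<in>f ` mspace X. \<exists>b\<in>g ` mspace Y. mdist Z a b \<le> r"
    and 2: "\<forall>b\<in>g ` mspace Y. \<exists>a\<in>f ` mspace X. mdist Z a b \<le> r"
  shows "correspondence X Y r {(x, y) \<in> mspace X \<times> mspace Y. mdist Z (f x) (g y) \<le> r}"
proof (rule correspondenceI; clarsimp?)
  show "\<exists>y. y \<in> mspace Y \<and> mdist Z (f x) (g y) \<le> r" if "x \<in> mspace X" for x
    using 1 that by auto
  show "\<exists>x. x \<in> mspace X \<and> mdist Z (f x) (g y) \<le> r" if "y \<in> mspace Y" for y
    using 2 that by auto
  fix x y x' y'
  assume *: "x \<in> mspace X" "x' \<in> mspace X" "y \<in> mspace Y" "y' \<in> mspace Y"
    "mdist Z (f x) (g y) \<le> r" "mdist Z (f x') (g y') \<le> r"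
  then have in_Z: "f x \<in> mspace Z" "f x' \<in> mspace Z" "g y \<in> mspace Z" "g y' \<in> mspace Z"
    using f g by (auto simp: isometric_embedding_def)
  have "mdist Z (f x) (f x') \<le> mdist Z (f x) (g y) + mdist Z (g y) (f x')"
       "mdist Z (g y) (f x') \<le> mdist Z (g y) (g y') + mdist Z (g y') (f x')"
       "mdist Z (g y) (g y') \<le> mdist Z (g y) (f x) + mdist Z (f x) (g y')"
       "mdist Z (f x) (g y') \<le> mdist Z (f x) (f x') + mdist Z (f x') (g y')"
    using in_Z by (auto intro: mdist_triangle)
  moreover have "mdist Z (f x) (f x') = mdist X x x'" "mdist Z (g y) (g y') = mdist Y y y'"
    using * f g by (auto simp: isometric_embedding_def)
  ultimately show "\<bar>mdist X x x' - mdist Y y y'\<bar> \<le> 2 * r"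
    using *(5,6) by (simp add: mdist_commute abs_le_iff)
qed

lemma hausdorff_dist_le:
  assumes "0 \<le> r" "\<forall>a\<in>A. \<exists>b\<in>B. mdist Z a b \<le> r" "\<forall>b\<in>B. \<exists>a\<in>A. mdist Z a b \<le> r"
  shows "hausdorff_dist Z A B \<le> r"
  unfolding hausdorff_dist_def using assms by (intro cInf_lower bdd_belowI[of _ 0]) auto

lemma embeddings_of_correspondence:
  fixes X Y :: "point metric"
  assumes R: "correspondence X Y r R" and "0 < r" and "mspace X \<noteq> {}"
  obtains Z :: "point metric" and f g
  where "isometric_embedding X Z f" "isometric_embedding Y Z g"
    "hausdorff_dist Z (f ` mspace X) (g ` mspace Y) \<le> r"
proof -
  have "R \<noteq> {}"
    using assms by (auto simp: correspondence_def)
  define c where "c x y = (INF (p, q)\<in>R. mdist X x p + mdist Y q y) + r" for x y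
  have c_le: "c x y \<le> mdist X x p + mdist Y q y + r" if "(p, q) \<in> R" for x y p q
  proof -
    have "(INF (p, q)\<in>R. mdist X x p + mdist Y q y) \<le> (case (p, q) of (p, q) \<Rightarrow> mdist X x p + mdist Y q y)"
      using that by (intro cINF_lower bdd_belowI[of _ 0]) auto
    then show ?thesis by (simp add: c_def)
  qed
  have c_ge: "b \<le> c x y" if "\<And>p q. (p, q) \<in> R \<Longrightarrow> b \<le> mdist X x p + mdist Y q y + r" for b x y
  proof -
    have "b - r \<le> (INF (p, q)\<in>R. mdist X x p + mdist Y q y)"
      using that \<open>R \<noteq> {}\<close> by (intro cINF_greatest) (auto simp: algebra_simps)
    then show ?thesis by (simp add: c_def)
  qed
  have c_pos: "c x y \<ge> r" for x y
    by (rule c_ge) simp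
  have tri1: "c x y \<le> mdist X x x' + c x' y" if "x \<in> mspace X" "x' \<in> mspace X" for x x' y
  proof -
    have "c x y - mdist X x x' \<le> c x' y"
    proof (rule c_ge)
      fix p q assume pq: "(p, q) \<in> R"
      then have "mdist X x p \<le> mdist X x x' + mdist X x' p"
        using that R by (intro mdist_triangle) (auto dest: correspondenceD)
      then show "c x y - mdist X x x' \<le> mdist X x' p + mdist Y q y + r"
        using c_le[OF pq, of x y] by linarith
    qed
    then show ?thesis by linarith
  qed
  have tri2: "c x y \<le> c x y' + mdist Y y' y" if "y \<in> mspace Y" "y' \<in> mspace Y" for x y y'
  proof -
    have "c x y - mdist Y y' y \<le> c x y'"
    proof (rule c_ge)
      fix p q assume pq: "(p, q) \<in> R"
      then have "mdist Y q y \<le> mdist Y q y' + mdist Y y' y"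
        using that R by (intro mdist_triangle) (auto dest: correspondenceD)
      then show "c x y - mdist Y y' y \<le> mdist X x p + mdist Y q y' + r"
        using c_le[OF pq, of x y] by linarith
    qed
    then show ?thesis by linarith
  qed
  have tri3: "mdist X x x' \<le> c x y + c x' y"
    if "x \<in> mspace X" "x' \<in> mspace X" "y \<in> mspace Y" for x x' y
  proof -
    have "mdist X x x' - c x' y \<le> c x y"
    proof (rule c_ge)
      fix p q assume pq: "(p, q) \<in> R"
      have "mdist X x x' - (mdist X x p + mdist Y q y + r) \<le> c x' y"
      proof (rule c_ge)
        fix p' q' assume pq': "(p', q') \<in> R"
        have "p \<in> mspace X" "p' \<in> mspace X" "q \<in> mspace Y" "q' \<in> mspace Y"
          using pq pq' R by (auto dest: correspondenceD)
        then have "mdist X x x' \<le> mdist X x p + mdist X p x'"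
            "mdist X p x' \<le> mdist X p p' + mdist X p' x'"
            "mdist Y q q' \<le> mdist Y q y + mdist Y y q'"
          using that by (auto intro: mdist_triangle)
        then show "mdist X x x' - (mdist X x p + mdist Y q y + r)
            \<le> mdist X x' p' + mdist Y q' y + r"
          using correspondenceD(5)[OF R pq pq'] by (simp add: mdist_commute abs_le_iff)
      qed
      then show "mdist X x x' - c x' y \<le> mdist X x p + mdist Y q y + r" by linarith
    qed
    then show ?thesis by linarith
  qed
  have tri4: "mdist Y y y' \<le> c x y + c x y'"
    if "x \<in> mspace X" "y \<in> mspace Y" "y' \<in> mspace Y" for x y y'
  proof -
    have "mdist Y y y' - c x y' \<le> c x y"
    proof (rule c_ge)
      fix p q assume pq: "(p, q) \<in> R"
      have "mdist Y y y' - (mdist X x p + mdist Y q y + r) \<le> c x y'"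
      proof (rule c_ge)
        fix p' q' assume pq': "(p', q') \<in> R"
        have "p \<in> mspace X" "p' \<in> mspace X" "q \<in> mspace Y" "q' \<in> mspace Y"
          using pq pq' R by (auto dest: correspondenceD)
        then have "mdist Y y y' \<le> mdist Y y q + mdist Y q y'"
            "mdist Y q y' \<le> mdist Y q q' + mdist Y q' y'"
            "mdist X p p' \<le> mdist X p x + mdist X x p'"
          using that by (auto intro: mdist_triangle)
        then show "mdist Y y y' - (mdist X x p + mdist Y q y + r)
            \<le> mdist X x p' + mdist Y q' y' + r"
          using correspondenceD(5)[OF R pq pq'] by (simp add: mdist_commute abs_le_iff)
      qed
      then show "mdist Y y y' - c x y' \<le> mdist X x p + mdist Y q y + r" by linarith
    qed
    then show ?thesis by linarith
  qed
  define d where "d u v = (case (u, v) of (Inl x, Inl x') \<Rightarrow> mdist X x x'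
      | (Inr y, Inr y') \<Rightarrow> mdist Y y y' | (Inl x, Inr y) \<Rightarrow> c x y | (Inr y, Inl x) \<Rightarrow> c x y)"
    for u v
  have d_simps: "d (Inl x) (Inl x') = mdist X x x'" "d (Inr y) (Inr y') = mdist Y y y'"
      "d (Inl x) (Inr y) = c x y" "d (Inr y) (Inl x) = c x y" for x x' y y'
    by (simp_all add: d_def)
  have c_nz: "c x y \<noteq> 0" "c x y \<ge> 0" for x y
    using c_pos[of x y] \<open>0 < r\<close> by auto
  interpret Metric_space "mspace X <+> mspace Y" d
  proof
    show "0 \<le> d u v" for u v
      by (cases u; cases v) (auto simp: d_simps c_nz)
    show "d u v = d v u" for u v
      by (cases u; cases v) (auto simp: d_simps mdist_commute)
    show "d u v = 0 \<longleftrightarrow> u = v" if "u \<in> mspace X <+> mspace Y" "v \<in> mspace X <+> mspace Y" for u v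
      using that by (auto simp: d_simps c_nz)
    show "d u w \<le> d u v + d v w"
      if "u \<in> mspace X <+> mspace Y" "v \<in> mspace X <+> mspace Y" "w \<in> mspace X <+> mspace Y" for u v w
    proof -
      have tri1': "c x' y \<le> c x y + mdist X x x'" if "x \<in> mspace X" "x' \<in> mspace X" for x x' y
        using tri1[of x' x y] that by (simp add: mdist_commute)
      have tri2': "c x y \<le> mdist Y y y' + c x y'" if "y \<in> mspace Y" "y' \<in> mspace Y" for x y y'
        using tri2[of y y' x] that by (simp add: mdist_commute)
      show ?thesis
        using that tri1 tri1' tri2 tri2' tri3 tri4 by (auto simp: d_simps mdist_triangle)
    qed
  qed
  let ?S = "metric (mspace X <+> mspace Y, d)"
  define h :: "point + point \<Rightarrow> point"
    where "h u = (case u of Inl x \<Rightarrow> case_nat 0 x | Inr y \<Rightarrow> case_nat 1 y)" for u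
  have "u = v" if "h u = h v" for u v
  proof -
    have "h u 0 = h v 0" "(\<lambda>n. h u (Suc n)) = (\<lambda>n. h v (Suc n))"
      using that by simp_all
    then show ?thesis
      by (cases u; cases v) (auto simp: h_def)
  qed
  then have inj: "inj_on h (mspace ?S)"
    by (blast intro: inj_onI)
  obtain Z :: "point metric" where Z: "mspace Z = h ` mspace ?S" "isometric_embedding ?S Z h"
    using metric_transport[OF inj] .
  have dZ: "mdist Z (h u) (h v) = d u v" if "u \<in> mspace X <+> mspace Y" "v \<in> mspace X <+> mspace Y" for u v
    using Z(2) that by (simp add: isometric_embedding_def)
  have 1: "isometric_embedding X Z (h \<circ> Inl)" "isometric_embedding Y Z (h \<circ> Inr)"
    using Z by (auto simp: isometric_embedding_def d_simps dZ InlI InrI)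
  have near: "mdist Z (h (Inl x)) (h (Inr y)) \<le> r" if "(x, y) \<in> R" for x y
  proof -
    have "c x y \<le> r"
      using c_le[OF that, of x y] correspondenceD(1,2)[OF R that, THEN mdist_refl] by simp
    then show ?thesis
      using correspondenceD(1,2)[OF R that] by (simp add: dZ InlI InrI d_simps)
  qed
  have "hausdorff_dist Z ((h \<circ> Inl) ` mspace X) ((h \<circ> Inr) ` mspace Y) \<le> r"
  proof (rule hausdorff_dist_le)
    show "\<forall>a\<in>(h \<circ> Inl) ` mspace X. \<exists>b\<in>(h \<circ> Inr) ` mspace Y. mdist Z a b \<le> r"
      using near R by (auto simp: bex_simps) (meson correspondenceD)
    show "\<forall>b\<in>(h \<circ> Inr) ` mspace Y. \<exists>a\<in>(h \<circ> Inl) ` mspace X. mdist Z a b \<le> r"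
      using near R by (auto simp: bex_simps) (meson correspondenceD)
  qed (use \<open>0 < r\<close> in simp)
  with 1 show thesis by (rule that)
qed

lemma hausdorff_dist_lessD:
  assumes X: "compact_metric X" and Y: "compact_metric Y"
    and f: "isometric_embedding X Z f" and g: "isometric_embedding Y Z g"
  shows "0 \<le> hausdorff_dist Z (f ` mspace X) (g ` mspace Y)"
    and "hausdorff_dist Z (f ` mspace X) (g ` mspace Y) < e \<Longrightarrow> \<exists>r R. 0 < r \<and> r < e \<and> correspondence X Y r R"
proof -
  let ?A = "f ` mspace X" and ?B = "g ` mspace Y"
  let ?h = "hausdorff_dist Z ?A ?B"
  let ?S = "{r. 0 \<le> r \<and> (\<forall>a\<in>?A. \<exists>b\<in>?B. mdist Z a b \<le> r) \<and> (\<forall>b\<in>?B. \<exists>a\<in>?A. mdist Z a b \<le> r)}"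
  obtain D where D: "0 \<le> D" "\<And>x x'. x \<in> mspace X \<Longrightarrow> x' \<in> mspace X \<Longrightarrow> mdist X x x' \<le> D"
    using compact_metric_bounded[OF X] by blast
  obtain E where E: "0 \<le> E" "\<And>y y'. y \<in> mspace Y \<Longrightarrow> y' \<in> mspace Y \<Longrightarrow> mdist Y y y' \<le> E"
    using compact_metric_bounded[OF Y] by blast
  obtain x0 y0 where x0: "x0 \<in> mspace X" and y0: "y0 \<in> mspace Y"
    using X Y by (auto simp: compact_metric_def)
  define C where "C = D + mdist Z (f x0) (g y0) + E"
  have le_C: "mdist Z (f x) (g y) \<le> C" if "x \<in> mspace X" "y \<in> mspace Y" for x y
  proof -
    have "f x \<in> mspace Z" "f x0 \<in> mspace Z" "g y \<in> mspace Z" "g y0 \<in> mspace Z"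
      using f g x0 y0 that by (auto simp: isometric_embedding_def)
    then have "mdist Z (f x) (g y) \<le> mdist Z (f x) (f x0) + mdist Z (f x0) (g y)"
        "mdist Z (f x0) (g y) \<le> mdist Z (f x0) (g y0) + mdist Z (g y0) (g y)"
      by (auto intro: mdist_triangle)
    moreover have "mdist Z (f x) (f x0) \<le> D" "mdist Z (g y0) (g y) \<le> E"
      using f g x0 y0 that D E by (auto simp: isometric_embedding_def)
    ultimately show ?thesis by (simp add: C_def)
  qed
  have "C \<ge> 0" using D E by (simp add: C_def)
  moreover have "\<exists>b\<in>?B. mdist Z a b \<le> C" if "a \<in> ?A" for a
    using that le_C y0 by auto
  moreover have "\<exists>a\<in>?A. mdist Z a b \<le> C" if "b \<in> ?B" for b
    using that le_C x0 by auto
  ultimately have "C \<in> ?S" by simp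
  then have ne: "?S \<noteq> {}" by (metis empty_iff)
  show "0 \<le> ?h"
    unfolding hausdorff_dist_def by (rule cInf_greatest[OF ne]) simp
  assume "?h < e"
  then have "\<exists>r\<in>?S. r < e"
    unfolding hausdorff_dist_def by (rule cInf_lessD[OF ne])
  then obtain r where r: "r \<in> ?S" "r < e" ..
  define s where "s = (r + e) / 2"
  have s: "r \<le> s" "0 < s" "s < e"
    using r by (auto simp: s_def)
  have "\<forall>a\<in>?A. \<exists>b\<in>?B. mdist Z a b \<le> r" "\<forall>b\<in>?B. \<exists>a\<in>?A. mdist Z a b \<le> r"
    using r(1) by simp_all
  then have "\<forall>a\<in>?A. \<exists>b\<in>?B. mdist Z a b \<le> s" "\<forall>b\<in>?B. \<exists>a\<in>?A. mdist Z a b \<le> s"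
    using s(1) by (fastforce intro: order_trans)+
  then show "\<exists>r R. 0 < r \<and> r < e \<and> correspondence X Y r R"
    using correspondence_of_embeddings[OF f g] s(2,3) by meson
qed

lemma correspondence_exists:
  assumes X: "compact_metric X" and Y: "compact_metric Y"
  shows "\<exists>r R. 0 < r \<and> correspondence X Y r R"
proof -
  obtain D where D: "0 \<le> D" "\<And>x x'. x \<in> mspace X \<Longrightarrow> x' \<in> mspace X \<Longrightarrow> mdist X x x' \<le> D"
    using compact_metric_bounded[OF X] by blast
  obtain E where E: "0 \<le> E" "\<And>y y'. y \<in> mspace Y \<Longrightarrow> y' \<in> mspace Y \<Longrightarrow> mdist Y y y' \<le> E"
    using compact_metric_bounded[OF Y] by blast
  have "correspondence X Y (D + E + 1) (mspace X \<times> mspace Y)"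
  proof (rule correspondenceI)
    fix x y x' y' assume "(x, y) \<in> mspace X \<times> mspace Y" "(x', y') \<in> mspace X \<times> mspace Y"
    then have "mdist X x x' \<le> D" "mdist Y y y' \<le> E" using D E by auto
    moreover have "\<bar>mdist X x x' - mdist Y y y'\<bar> \<le> mdist X x x' + mdist Y y y'"
      by (simp add: abs_le_iff)
    ultimately have "\<bar>mdist X x x' - mdist Y y y'\<bar> \<le> D + E"
      by (meson add_mono order_trans)
    also have "D + E \<le> 2 * (D + E + 1)"
      using D(1) E(1) by simp
    finally show "\<bar>mdist X x x' - mdist Y y y'\<bar> \<le> 2 * (D + E + 1)" .
  qed (use X Y in \<open>auto simp: compact_metric_def\<close>)
  moreover have "0 < D + E + 1"
    using D(1) E(1) by (simp add: abs_le_iff)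
  ultimately show ?thesis by blast
qed


section \<open>The Gromov-Hausdorff distance is a metric up to isometry\<close>

lemma gh_distance_nonempty:
  fixes X Y :: "point metric"
  assumes "compact_metric X" "compact_metric Y"
  shows "{hausdorff_dist Z (f ` mspace X) (g ` mspace Y) | (Z :: point metric) f g.
           isometric_embedding X Z f \<and> isometric_embedding Y Z g} \<noteq> {}"
proof -
  obtain r R where "0 < r" "correspondence X Y r R"
    using correspondence_exists[OF assms] by blast
  then obtain Z :: "point metric" and f g
    where "isometric_embedding X Z f" "isometric_embedding Y Z g"
    using assms by (metis embeddings_of_correspondence compact_metric_def)
  then show ?thesis by blast
qed

lemma gh_distance_nonneg:
  fixes X Y :: "point metric"
  assumes "compact_metric X" "compact_metric Y"
  shows "0 \<le> gh_distance X Y"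
  unfolding gh_distance_def
  by (rule cInf_greatest[OF gh_distance_nonempty[OF assms]])
     (use hausdorff_dist_lessD(1)[OF assms] in blast)

lemma gh_distance_less_iff:
  fixes X Y :: "point metric"
  assumes "compact_metric X" "compact_metric Y"
  shows "gh_distance X Y < e \<longleftrightarrow> (\<exists>r R. 0 < r \<and> r < e \<and> correspondence X Y r R)"
proof
  assume "gh_distance X Y < e"
  then obtain Z :: "point metric" and f g
    where "isometric_embedding X Z f" "isometric_embedding Y Z g"
      "hausdorff_dist Z (f ` mspace X) (g ` mspace Y) < e"
    unfolding gh_distance_def using cInf_lessD[OF gh_distance_nonempty[OF assms]] by blast
  then show "\<exists>r R. 0 < r \<and> r < e \<and> correspondence X Y r R"
    using hausdorff_dist_lessD(2)[OF assms] by blast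
next
  assume "\<exists>r R. 0 < r \<and> r < e \<and> correspondence X Y r R"
  then obtain r R where r: "0 < r" "r < e" "correspondence X Y r R"
    by blast
  then obtain Z :: "point metric" and f g
    where Z: "isometric_embedding X Z f" "isometric_embedding Y Z g"
      "hausdorff_dist Z (f ` mspace X) (g ` mspace Y) \<le> r"
    using assms by (metis embeddings_of_correspondence compact_metric_def)
  have "gh_distance X Y \<le> hausdorff_dist Z (f ` mspace X) (g ` mspace Y)"
    unfolding gh_distance_def using Z(1,2) hausdorff_dist_lessD(1)[OF assms]
    by (intro cInf_lower bdd_belowI[of _ 0]) blast+
  with Z(3) r(2) show "gh_distance X Y < e" by linarith
qed

theorem gh_distance_le:
  fixes X Y :: "point metric" and Z :: "'z metric"
  assumes "compact_metric X" "compact_metric Y"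
    and "isometric_embedding X Z f" "isometric_embedding Y Z g"
  shows "gh_distance X Y \<le> hausdorff_dist Z (f ` mspace X) (g ` mspace Y)"
proof (rule dense_ge)
  fix e assume "hausdorff_dist Z (f ` mspace X) (g ` mspace Y) < e"
  then show "gh_distance X Y \<le> e"
    using hausdorff_dist_lessD(2)[OF assms] gh_distance_less_iff[OF assms(1,2)]
    by (meson less_imp_le)
qed

lemma gh_distance_commute_le:
  fixes X Y :: "point metric"
  assumes "compact_metric X" "compact_metric Y"
  shows "gh_distance X Y \<le> gh_distance Y X"
proof (rule dense_ge)
  fix e assume "gh_distance Y X < e"
  then show "gh_distance X Y \<le> e"
    using assms gh_distance_less_iff correspondence_converse by (meson less_imp_le)
qed

lemma gh_distance_commute:
  fixes X Y :: "point metric"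
  assumes "compact_metric X" "compact_metric Y"
  shows "gh_distance X Y = gh_distance Y X"
  using gh_distance_commute_le[OF assms] gh_distance_commute_le[OF assms(2,1)] by simp

lemma gh_distance_triangle:
  fixes X Y Z :: "point metric"
  assumes X: "compact_metric X" and Y: "compact_metric Y" and Z: "compact_metric Z"
  shows "gh_distance X Z \<le> gh_distance X Y + gh_distance Y Z"
proof (rule field_le_epsilon)
  fix e :: real assume "e > 0"
  then have "gh_distance X Y < gh_distance X Y + e / 2" "gh_distance Y Z < gh_distance Y Z + e / 2"
    by simp_all
  then obtain r R s S where r: "0 < r" "r < gh_distance X Y + e / 2" "correspondence X Y r R"
    and s: "0 < s" "s < gh_distance Y Z + e / 2" "correspondence Y Z s S"
    using gh_distance_less_iff[OF X Y] gh_distance_less_iff[OF Y Z] by meson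
  have "0 < r + s" "r + s < gh_distance X Y + gh_distance Y Z + e"
    using r s by linarith+
  then have "gh_distance X Z < gh_distance X Y + gh_distance Y Z + e"
    using gh_distance_less_iff[OF X Z] correspondence_comp[OF r(3) s(3)] by meson
  then show "gh_distance X Z \<le> gh_distance X Y + gh_distance Y Z + e" by simp
qed

lemma gh_distance_eq_0_if_isometric:
  fixes X Y :: "point metric"
  assumes X: "compact_metric X" and Y: "compact_metric Y" and "isometric X Y"
  shows "gh_distance X Y = 0"
proof -
  obtain f where f: "isometric_embedding X Y f" "f ` mspace X = mspace Y"
    using assms(3) by (auto simp: isometric_def)
  have "gh_distance X Y < e" if "0 < e" for e
  proof -
    have "correspondence X Y (e / 2) {(x, f x) | x. x \<in> mspace X}"
      using f that by (intro correspondenceI) (auto simp: isometric_embedding_def)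
    moreover have "0 < e / 2" "e / 2 < e" using that by auto
    ultimately show ?thesis
      unfolding gh_distance_less_iff[OF X Y] by blast
  qed
  then have "gh_distance X Y \<le> 0"
    by (meson dense_ge less_imp_le)
  then show ?thesis
    using gh_distance_nonneg[OF X Y] by simp
qed

lemma isometric_embedding_if_gh_distance_0:
  fixes X Y :: "point metric"
  assumes X: "compact_metric X" and Y: "compact_metric Y" and 0: "gh_distance X Y = 0"
  shows "\<exists>f. isometric_embedding X Y f"
proof -
  interpret Y: Metric_space "mspace Y" "mdist Y" by blast
  let ?I = "mspace X"
  define T where "T = product_topology (\<lambda>_. Y.mtopology) ?I"
  have top: "topspace T = (\<Pi>\<^sub>E x\<in>?I. mspace Y)"
    by (simp add: T_def)
  have cT: "compact_space T"
    using Y by (simp add: T_def compact_space_product_topology compact_metric_def mtopology_of_def)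
  define C where "C = (\<lambda>(x, x', n :: nat).
      {\<phi> \<in> topspace T. \<bar>mdist Y (\<phi> x) (\<phi> x') - mdist X x x'\<bar> \<le> 1 / Suc n})"
  let ?J = "?I \<times> ?I \<times> (UNIV :: nat set)"
  have closed: "closedin T (C j)" if "j \<in> ?J" for j
  proof -
    obtain x x' n where "j = (x, x', n)"
      by (rule prod_cases3)
    with that have j: "j = (x, x', n)" "x \<in> ?I" "x' \<in> ?I"
      by simp_all
    have proj: "continuous_map T Y.mtopology (\<lambda>\<phi>. \<phi> z)" if "z \<in> ?I" for z
      using that unfolding T_def by (intro continuous_map_product_projection)
    have "continuous_map T euclideanreal (\<lambda>\<phi>. mdist Y (\<phi> x) (\<phi> x'))"
      using proj[OF j(2)] proj[OF j(3)]
      by (intro continuous_map_mdist) (simp_all add: mtopology_of_def)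
    then have "continuous_map T euclideanreal (\<lambda>\<phi>. \<bar>mdist Y (\<phi> x) (\<phi> x') - mdist X x x'\<bar>)"
      by (intro continuous_map_real_abs continuous_map_diff) simp_all
    then have "closedin T {\<phi> \<in> topspace T. \<bar>mdist Y (\<phi> x) (\<phi> x') - mdist X x x'\<bar> \<in> {..1 / Suc n}}"
      by (rule closedin_continuous_map_preimage) simp
    then show ?thesis
      by (simp add: C_def j)
  qed
  have fip: "topspace T \<inter> \<Inter>F \<noteq> {}" if F: "finite F" "F \<subseteq> C ` ?J" for F
  proof -
    obtain J where J: "finite J" "J \<subseteq> ?J" "F = C ` J"
      using finite_subset_image[OF F] by blast
    define N where "N = Max (insert 0 ((\<lambda>(x, x', n). n) ` J))"
    have N: "n \<le> N" if "(x, x', n) \<in> J" for x x' n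
      unfolding N_def using J(1) that by (intro Max_ge) force+
    have "gh_distance X Y < 1 / (2 * Suc N)"
      using 0 by simp
    then obtain r R where r: "0 < r" "r < 1 / (2 * Suc N)" "correspondence X Y r R"
      unfolding gh_distance_less_iff[OF X Y] by blast
    define \<phi> where "\<phi> = restrict (\<lambda>x. SOME y. (x, y) \<in> R) ?I"
    have R: "(x, \<phi> x) \<in> R" if "x \<in> ?I" for x
      using someI_ex[OF correspondenceD(3)[OF r(3) that]] that by (simp add: \<phi>_def)
    have \<phi>: "\<phi> \<in> topspace T"
      using R correspondenceD(2)[OF r(3)] by (auto simp: top \<phi>_def)
    have "\<phi> \<in> C j" if jJ: "j \<in> J" for j
    proof -
      obtain x x' n where "j = (x, x', n)"
        by (rule prod_cases3)
      with jJ J(2) N[of x x' n] have j: "j = (x, x', n)" "x \<in> ?I" "x' \<in> ?I" "n \<le> N"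
        by auto
      have "\<bar>mdist X x x' - mdist Y (\<phi> x) (\<phi> x')\<bar> \<le> 2 * r"
        using correspondenceD(5)[OF r(3) R R] j by blast
      also have "2 * r \<le> 1 / Suc N"
        using r(2) by (simp add: field_simps)
      also have "\<dots> \<le> 1 / Suc n"
        using j(4) by (simp add: frac_le)
      finally show ?thesis
        using \<phi> by (simp add: C_def j(1) abs_minus_commute)
    qed
    then show ?thesis
      using \<phi> J(3) by blast
  qed
  have "\<Inter>(insert (topspace T) (C ` ?J)) \<noteq> {}"
  proof (rule compact_space_fip[THEN iffD1, OF cT, rule_format])
    show "(\<forall>K\<in>insert (topspace T) (C ` ?J). closedin T K) \<and>
      (\<forall>F. finite F \<and> F \<subseteq> insert (topspace T) (C ` ?J) \<longrightarrow> \<Inter>F \<noteq> {})"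
    proof (intro conjI allI impI)
      show "\<forall>K\<in>insert (topspace T) (C ` ?J). closedin T K"
        using closed by blast
      fix F assume F: "finite F \<and> F \<subseteq> insert (topspace T) (C ` ?J)"
      then have "topspace T \<inter> \<Inter>(F - {topspace T}) \<noteq> {}"
        by (intro fip) auto
      then show "\<Inter>F \<noteq> {}" by blast
    qed
  qed
  then obtain \<phi> where "\<phi> \<in> \<Inter>(insert (topspace T) (C ` ?J))"
    unfolding ex_in_conv[symmetric] ..
  then have \<phi>: "\<phi> \<in> topspace T" "\<And>j. j \<in> ?J \<Longrightarrow> \<phi> \<in> C j"
    by (simp_all only: Inter_iff ball_simps)
  have "mdist Y (\<phi> x) (\<phi> x') = mdist X x x'" if "x \<in> ?I" "x' \<in> ?I" for x x'
  proof -
    have *: "\<bar>mdist Y (\<phi> x) (\<phi> x') - mdist X x x'\<bar> \<le> 1 / Suc n" for n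
      using \<phi>(2)[of "(x, x', n)"] that by (simp add: C_def)
    have "\<bar>mdist Y (\<phi> x) (\<phi> x') - mdist X x x'\<bar> \<le> 0"
    proof (rule ccontr)
      assume "\<not> ?thesis"
      then have "0 < \<bar>mdist Y (\<phi> x) (\<phi> x') - mdist X x x'\<bar>" by simp
      then obtain n where "1 / Suc n < \<bar>mdist Y (\<phi> x) (\<phi> x') - mdist X x x'\<bar>"
        by (rule nat_approx_posE)
      with *[of n] show False by simp
    qed
    then show ?thesis by simp
  qed
  moreover have "\<phi> \<in> ?I \<rightarrow> mspace Y"
    using \<phi>(1) top by auto
  ultimately show ?thesis
    unfolding isometric_embedding_def by blast
qed

lemma compact_metric_self_embedding_surj:
  assumes X: "compact_metric X" and f: "isometric_embedding X X f"
  shows "f ` mspace X = mspace X"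
proof (rule ccontr)
  assume "f ` mspace X \<noteq> mspace X"
  moreover have fX: "f ` mspace X \<subseteq> mspace X"
    using f by (auto simp: isometric_embedding_def)
  ultimately obtain a where a: "a \<in> mspace X" "a \<notin> f ` mspace X"
    by blast
  interpret Metric_space "mspace X" "mdist X" by blast
  interpret XX: Metric_space12 "mspace X" "mdist X" "mspace X" "mdist X" ..
  have cpt: "compact_space mtopology"
    using X by (simp add: compact_metric_def mtopology_of_def)
  have "embedding_map mtopology mtopology f"
    using f by (intro XX.isometry_imp_embedding_map) (auto simp: isometric_embedding_def)
  then have "continuous_map mtopology mtopology f"
    unfolding embedding_map_def
    by (meson continuous_map_in_subtopology homeomorphic_imp_continuous_map)
  then have "compactin mtopology (f ` mspace X)"
    using cpt image_compactin by (metis compact_space_def topspace_mtopology)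
  then have "closedin mtopology (f ` mspace X)"
    using Hausdorff_space_mtopology compactin_imp_closedin by blast
  then obtain e where e: "e > 0" "disjnt (f ` mspace X) (mball a e)"
    using a unfolding closedin_metric by blast
  define s where "s n = (f ^^ n) a" for n
  have s: "s n \<in> mspace X" for n
    by (induction n) (use a fX in \<open>auto simp: s_def\<close>)
  have shift: "mdist X (s (k + m)) (s (k + n)) = mdist X (s m) (s n)" for k m n
  proof (induction k)
    case (Suc k)
    have "mdist X (f (s (k + m))) (f (s (k + n))) = mdist X (s (k + m)) (s (k + n))"
      using f s by (simp add: isometric_embedding_def)
    then show ?case
      using Suc by (simp add: s_def)
  qed simp
  have far: "mdist X (s m) (s n) \<ge> e" if mn: "m < n" for m n
  proof -
    obtain k where "n = Suc (m + k)"
      using less_imp_Suc_add[OF mn] by blast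
    then have k: "n = m + Suc k"
      by simp
    have "mdist X (s m) (s n) = mdist X a (s (Suc k))"
      using shift[of m 0 "Suc k"] by (simp add: k s_def)
    moreover have "s (Suc k) \<in> f ` mspace X"
      using s[of k] by (auto simp: s_def)
    then have "s (Suc k) \<notin> mball a e"
      using e(2) by (meson disjnt_iff)
    ultimately show ?thesis
      using a s by auto
  qed
  have "range s \<subseteq> mspace X"
    using s by blast
  then obtain l and \<sigma> :: "nat \<Rightarrow> nat"
    where \<sigma>: "strict_mono \<sigma>" and lim: "limitin mtopology (s \<circ> \<sigma>) l sequentially"
    using compact_space_sequentially[THEN iffD1, OF cpt, rule_format, of s] by blast
  have "range (s \<circ> \<sigma>) \<subseteq> mspace X"
    using s by auto
  with lim have "MCauchy (s \<circ> \<sigma>)"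
    by (rule convergent_imp_MCauchy[rotated])
  then have "\<exists>N. \<forall>m n. N \<le> m \<longrightarrow> N \<le> n \<longrightarrow> mdist X (s (\<sigma> m)) (s (\<sigma> n)) < e"
    using e(1) unfolding MCauchy_def by simp
  then obtain N where "\<forall>m n. N \<le> m \<longrightarrow> N \<le> n \<longrightarrow> mdist X (s (\<sigma> m)) (s (\<sigma> n)) < e" ..
  then have "mdist X (s (\<sigma> N)) (s (\<sigma> (Suc N))) < e"
    by simp
  moreover have "\<sigma> N < \<sigma> (Suc N)"
    using \<sigma> by (simp add: strict_mono_def)
  ultimately show False
    using far[of "\<sigma> N" "\<sigma> (Suc N)"] by simp
qed

lemma gh_distance_eq_0_iff:
  fixes X Y :: "point metric"
  assumes X: "compact_metric X" and Y: "compact_metric Y"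
  shows "gh_distance X Y = 0 \<longleftrightarrow> isometric X Y"
proof
  assume 0: "gh_distance X Y = 0"
  obtain f where f: "isometric_embedding X Y f"
    using isometric_embedding_if_gh_distance_0[OF X Y 0] by blast
  obtain g where g: "isometric_embedding Y X g"
    using isometric_embedding_if_gh_distance_0[OF Y X] 0 gh_distance_commute[OF X Y] by auto
  have "isometric_embedding Y Y (f \<circ> g)"
    using f g by (auto simp: isometric_embedding_def Pi_iff)
  then have "(f \<circ> g) ` mspace Y = mspace Y"
    by (rule compact_metric_self_embedding_surj[OF Y])
  then have "f ` mspace X = mspace Y"
    using f g by (fastforce simp: isometric_embedding_def)
  with f show "isometric X Y"
    unfolding isometric_def by blast
qed (rule gh_distance_eq_0_if_isometric[OF X Y])


section \<open>The Gromov-Hausdorff space\<close>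

definition gh_rel :: "point metric \<Rightarrow> point metric \<Rightarrow> bool"
  where "gh_rel X Y \<longleftrightarrow> compact_metric X \<and> compact_metric Y \<and> isometric X Y"

lemma compact_metric_exists: "\<exists>X :: point metric. compact_metric X"
proof -
  define X :: "point metric" where "X = metric ({\<lambda>_. 0}, \<lambda>_ _. 0)"
  have "Metric_space {p} (\<lambda>_ _. 0)" for p :: point
    unfolding Metric_space_def by simp
  then have "mspace X = {\<lambda>_. 0}"
    unfolding X_def by (rule Metric_space.mspace_metric)
  then have "compact_metric X"
    by (simp add: compact_metric_def compact_space_def finite_imp_compactin)
  then show ?thesis ..
qed

quotient_type gh_space = "point metric" / partial: gh_rel
proof (rule part_equivpI)
  show "\<exists>X. gh_rel X X"
    using compact_metric_exists by (auto simp: gh_rel_def isometric_refl)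
  show "symp gh_rel"
    by (rule sympI) (simp add: gh_rel_def isometric_sym)
  show "transp gh_rel"
    by (rule transpI) (meson gh_rel_def isometric_trans)
qed

instantiation gh_space :: metric_space
begin

lift_definition dist_gh_space :: "gh_space \<Rightarrow> gh_space \<Rightarrow> real" is gh_distance
proof -
  fix X X' Y Y' assume "gh_rel X X'" "gh_rel Y Y'"
  then have c: "compact_metric X" "compact_metric X'" "compact_metric Y" "compact_metric Y'"
    and 0: "gh_distance X X' = 0" "gh_distance Y Y' = 0"
    by (auto simp: gh_rel_def gh_distance_eq_0_iff)
  show "gh_distance X Y = gh_distance X' Y'"
    using 0 gh_distance_triangle[OF c(1,2,3)] gh_distance_triangle[OF c(2,4,3)]
      gh_distance_triangle[OF c(2,1,4)] gh_distance_triangle[OF c(1,3,4)]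
      gh_distance_commute[OF c(1,2)] gh_distance_commute[OF c(3,4)]
    by linarith
qed

definition uniformity_gh_space :: "(gh_space \<times> gh_space) filter"
  where "uniformity_gh_space = (INF e\<in>{0<..}. principal {(X, Y). dist X Y < e})"

definition open_gh_space :: "gh_space set \<Rightarrow> bool"
  where "open_gh_space U \<longleftrightarrow> (\<forall>X\<in>U. \<forall>\<^sub>F (X', Y) in uniformity. X' = X \<longrightarrow> Y \<in> U)"

instance
proof
  fix X Y Z :: gh_space
  show "dist X Y = 0 \<longleftrightarrow> X = Y"
    by transfer (simp add: gh_rel_def gh_distance_eq_0_iff)
  show "dist X Y \<le> dist X Z + dist Y Z"
  proof transfer
    fix X Y Z assume "gh_rel X X" "gh_rel Y Y" "gh_rel Z Z"
    then have c: "compact_metric X" "compact_metric Y" "compact_metric Z"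
      by (simp_all add: gh_rel_def)
    show "gh_distance X Y \<le> gh_distance X Z + gh_distance Y Z"
      using gh_distance_triangle[OF c(1,3,2)] gh_distance_commute[OF c(2,3)] by simp
  qed
qed (rule uniformity_gh_space_def, rule open_gh_space_def)

end

lift_definition gh_totally_anisometric :: "gh_space \<Rightarrow> bool" is totally_anisometric
  by (meson gh_rel_def isometric_sym totally_anisometric_isometric_imp)

end

theory Submission
  imports Defs
begin

text \<open>
  A space that is not totally anisometric has, for some \<open>e > 0\<close>, two pairs of points at the same
  distance \<open>\<ge> e\<close> that are \<open>e\<close>-apart as unordered pairs. For fixed \<open>e\<close> this is excluded in a whole ball
  around any finite totally anisometric space, since its finitely many distances have a positive
  gap. Finite totally anisometric spaces are dense: add to the distances of a finite net of \<open>X\<close>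
  generic corrections from an interval \<open>[\<eta>, 2\<eta>]\<close>, which cannot violate the triangle
  inequality because \<open>2\<eta> \<le> \<eta> + \<eta>\<close>.
\<close>

section \<open>Quantitative failure of total anisometry\<close>

text \<open>The two disjunctions say that each of the two ways of matching \<open>{x, y}\<close>
  with \<open>{x', y'}\<close> moves some point by at least \<open>e\<close>. Using \<open>e\<close>
  also as the lower bound on the common distance leaves a single parameter to exhaust.\<close>

definition has_repeated_distance :: "real \<Rightarrow> 'a metric \<Rightarrow> bool"
  where "has_repeated_distance e X \<longleftrightarrow>
    (\<exists>x\<in>mspace X. \<exists>y\<in>mspace X. \<exists>x'\<in>mspace X. \<exists>y'\<in>mspace X.
       mdist X x y = mdist X x' y' \<and> mdist X x y \<ge> e \<and>
       (mdist X x x' \<ge> e \<or> mdist X y y' \<ge> e) \<and> (mdist X x y' \<ge> e \<or> mdist X y x' \<ge> e))"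

lemma not_totally_anisometric_iff:
  "\<not> totally_anisometric X \<longleftrightarrow> (\<exists>n. has_repeated_distance (1 / real (Suc n)) X)"
proof
  assume "\<not> totally_anisometric X"
  then obtain x y x' y'
    where mem: "x \<in> mspace X" "y \<in> mspace X" "x' \<in> mspace X" "y' \<in> mspace X"
      and eq: "mdist X x y = mdist X x' y'" and pos: "mdist X x y > 0" and ne: "{x, y} \<noteq> {x', y'}"
    unfolding totally_anisometric_def by blast
  have nonneg: "mdist X u v \<ge> 0" for u v
    by simp
  \<comment> \<open>\<open>m\<close> is the largest threshold that these four points meet:
    \<open>min\<close> renders the conjunctions and \<open>max\<close> the disjunctions of
    \<open>has_repeated_distance\<close>.\<close>
  define m where "m = min (mdist X x y)
    (min (max (mdist X x x') (mdist X y y')) (max (mdist X x y') (mdist X y x')))"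
  have "x \<noteq> x' \<or> y \<noteq> y'" "x \<noteq> y' \<or> y \<noteq> x'"
    using ne by auto
  then have "mdist X x x' > 0 \<or> mdist X y y' > 0" "mdist X x y' > 0 \<or> mdist X y x' > 0"
    using mem by (metis nonneg mdist_zero order_less_le)+
  then have "m > 0"
    using pos by (auto simp: m_def)
  then obtain n where "1 / real (Suc n) < m"
    by (rule nat_approx_posE)
  then have "has_repeated_distance (1 / real (Suc n)) X"
    unfolding has_repeated_distance_def
    by (intro bexI[OF _ mem(1)] bexI[OF _ mem(2)] bexI[OF _ mem(3)] bexI[OF _ mem(4)])
       (use eq in \<open>auto simp: m_def less_max_iff_disj\<close>)
  then show "\<exists>n. has_repeated_distance (1 / real (Suc n)) X" ..
next
  assume "\<exists>n. has_repeated_distance (1 / real (Suc n)) X"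
  then obtain n x y x' y'
    where mem: "x \<in> mspace X" "y \<in> mspace X" "x' \<in> mspace X" "y' \<in> mspace X"
      and d: "mdist X x y = mdist X x' y'" "mdist X x y \<ge> 1 / real (Suc n)"
        "mdist X x x' \<ge> 1 / real (Suc n) \<or> mdist X y y' \<ge> 1 / real (Suc n)"
        "mdist X x y' \<ge> 1 / real (Suc n) \<or> mdist X y x' \<ge> 1 / real (Suc n)"
    unfolding has_repeated_distance_def by blast
  have p: "1 / real (Suc n) > 0"
    by simp
  have "mdist X u u < 1 / real (Suc n)" if "u \<in> mspace X" for u
    using mdist_refl[OF that] p by linarith
  then have "{x, y} \<noteq> {x', y'}"
    using d(3,4) mem by (metis doubleton_eq_iff not_le)
  moreover have "mdist X x y > 0"
    using d(2) p by linarith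
  ultimately show "\<not> totally_anisometric X"
    using mem d(1) unfolding totally_anisometric_def by blast
qed

section \<open>Stability near finite totally anisometric spaces\<close>

text \<open>Only finitely many differences of distances occur, so the nonzero ones stay away from
  0.\<close>

lemma finite_metric_distance_gap:
  assumes "finite (mspace Y)"
  obtains s where "s > 0" "\<And>u v u' v'. \<lbrakk>u \<in> mspace Y; v \<in> mspace Y; u' \<in> mspace Y; v' \<in> mspace Y;
    \<bar>mdist Y u v - mdist Y u' v'\<bar> < s\<rbrakk> \<Longrightarrow> mdist Y u v = mdist Y u' v'"
proof -
  let ?M = "mspace Y"
  define S where "S = (\<lambda>((u, v), (u', v')). mdist Y u v - mdist Y u' v') ` ((?M \<times> ?M) \<times> (?M \<times> ?M))"
  have "finite S"
    using assms unfolding S_def by blast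
  then obtain s where s: "s > 0" "\<forall>t\<in>S. t \<noteq> 0 \<longrightarrow> s \<le> dist 0 t"
    using finite_set_avoid by blast
  show thesis
  proof (rule that[OF s(1)])
    fix u v u' v' assume "u \<in> ?M" "v \<in> ?M" "u' \<in> ?M" "v' \<in> ?M"
      and lt: "\<bar>mdist Y u v - mdist Y u' v'\<bar> < s"
    then have "mdist Y u v - mdist Y u' v' \<in> S"
      unfolding S_def by force
    with s(2) lt show "mdist Y u v = mdist Y u' v'"
      by fastforce
  qed
qed

text \<open>A repeated distance in \<open>Z\<close> is pulled back along \<open>R\<close>: the gap
  makes the two distances in \<open>Y\<close> equal, anisometry identifies the two pairs in
  \<open>Y\<close>, and points of \<open>Z\<close> related to one point of \<open>Y\<close> are too
  close to be \<open>e\<close>-apart.\<close>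

lemma no_repeated_distance_near:
  assumes "finite (mspace Y)" "totally_anisometric Y" "e > 0"
  obtains \<delta> where "\<delta> > 0"
    "\<And>Z r R. \<lbrakk>r < \<delta>; correspondence Y Z r R\<rbrakk> \<Longrightarrow> \<not> has_repeated_distance e Z"
proof -
  obtain s where s: "s > 0" and gap: "\<And>u v u' v'. \<lbrakk>u \<in> mspace Y; v \<in> mspace Y; u' \<in> mspace Y;
      v' \<in> mspace Y; \<bar>mdist Y u v - mdist Y u' v'\<bar> < s\<rbrakk> \<Longrightarrow> mdist Y u v = mdist Y u' v'"
    using finite_metric_distance_gap[OF assms(1)] by metis
  show thesis
  \<comment> \<open>Two distances are compared, each distorted by at most \<open>2 * r\<close>,
    hence \<open>s / 4\<close>. The bound \<open>2 * r < e\<close> keeps the pulled-back distance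
    positive and gives \<open>close\<close>.\<close>
  proof (rule that[of "min (s / 4) (e / 2)"])
    show "min (s / 4) (e / 2) > 0"
      using s assms by simp
    fix Z :: "'b metric" and r R
    assume "r < min (s / 4) (e / 2)" and R: "correspondence Y Z r R"
    then have r: "4 * r < s" "2 * r < e"
      by auto
    show "\<not> has_repeated_distance e Z"
    proof
      assume "has_repeated_distance e Z"
      then obtain x y x' y'
        where mem: "x \<in> mspace Z" "y \<in> mspace Z" "x' \<in> mspace Z" "y' \<in> mspace Z"
          and d: "mdist Z x y = mdist Z x' y'" "mdist Z x y \<ge> e"
            "mdist Z x x' \<ge> e \<or> mdist Z y y' \<ge> e" "mdist Z x y' \<ge> e \<or> mdist Z y x' \<ge> e"
        unfolding has_repeated_distance_def by blast
      obtain u v u' v' where uv: "(u, x) \<in> R" "(v, y) \<in> R" "(u', x') \<in> R" "(v', y') \<in> R"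
        using correspondenceD(4)[OF R] mem by meson
      note memY = uv[THEN correspondenceD(1)[OF R]]
      note dis = correspondenceD(5)[OF R]
      have close: "mdist Z a b < e" if "(w, a) \<in> R" "(w, b) \<in> R" for w a b
        using dis[OF that] r(2) mdist_refl[OF correspondenceD(1)[OF R that(1)]] by linarith
      have "mdist Y u v = mdist Y u' v'"
        using dis[OF uv(1,2)] dis[OF uv(3,4)] d(1) r(1) by (intro gap memY) linarith
      moreover have "mdist Y u v > 0"
        using dis[OF uv(1,2)] d(2) r(2) by linarith
      ultimately have "{u, v} = {u', v'}"
        using assms(2) memY unfolding totally_anisometric_def by blast
      then have "u = u' \<and> v = v' \<or> u = v' \<and> v = u'"
        by (simp add: doubleton_eq_iff)
      then show False
        using d(3,4) close uv by (meson not_le)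
    qed
  qed
qed

section \<open>Density of finite totally anisometric spaces\<close>

text \<open>Greedy choice: finitely many values already taken cannot exhaust an infinite
  set.\<close>

lemma injective_choice_from_infinite_sets:
  assumes "finite P" "\<And>p. p \<in> P \<Longrightarrow> infinite (I p)"
  shows "\<exists>h. inj_on h P \<and> (\<forall>p\<in>P. h p \<in> I p)"
  using assms
proof (induction P)
  case (insert p P)
  then obtain h where h: "inj_on h P" "\<forall>q\<in>P. h q \<in> I q"
    by auto
  have "infinite (I p - h ` P)"
    using insert by (intro Diff_infinite_finite) auto
  then obtain t where "t \<in> I p" "t \<notin> h ` P"
    by (metis Diff_iff ex_in_conv finite.emptyI)
  then have "inj_on (h(p := t)) (insert p P) \<and> (\<forall>q\<in>insert p P. (h(p := t)) q \<in> I q)"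
    using h insert.hyps(2) by (auto simp: inj_on_def)
  then show ?case
    by (intro exI[of _ "h(p := t)"])
qed simp

text \<open>New distances are chosen per unordered pair, so that symmetry is automatic and
  injectivity of the choice is what total anisometry asks for.\<close>

lemma totally_anisometric_perturbation:
  fixes X :: "'a metric"
  assumes F: "finite F" "F \<subseteq> mspace X" and \<eta>: "\<eta> > 0"
  obtains Y :: "'a metric" where "mspace Y = F" "totally_anisometric Y"
    "\<And>x y. x \<in> F \<Longrightarrow> y \<in> F \<Longrightarrow> \<bar>mdist Y x y - mdist X x y\<bar> \<le> 2 * \<eta>"
proof -
  define P where "P = (\<lambda>(x, y). {x, y}) ` (F \<times> F)"
  \<comment> \<open>By symmetry of \<open>mdist X\<close> the interval does not depend on how the
    pair is ordered.\<close>
  define I where "I p = {t. \<exists>x y. p = {x, y} \<and> t \<in> {mdist X x y + \<eta> .. mdist X x y + 2 * \<eta>}}" for p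
  have I: "I {x, y} = {mdist X x y + \<eta> .. mdist X x y + 2 * \<eta>}" for x y
    unfolding I_def by (auto simp: doubleton_eq_iff) (auto simp: mdist_commute)
  have "finite P"
    using F(1) unfolding P_def by blast
  moreover have "infinite (I p)" if "p \<in> P" for p
    using that \<eta> by (auto simp: P_def I infinite_Icc)
  ultimately have "\<exists>h. inj_on h P \<and> (\<forall>p\<in>P. h p \<in> I p)"
    by (rule injective_choice_from_infinite_sets)
  then obtain h where h: "inj_on h P" "\<forall>p\<in>P. h p \<in> I p"
    by blast
  have P: "{x, y} \<in> P" if "x \<in> F" "y \<in> F" for x y
    using that by (auto simp: P_def)
  have bounds: "mdist X x y + \<eta> \<le> h {x, y}" "h {x, y} \<le> mdist X x y + 2 * \<eta>"
    if "x \<in> F" "y \<in> F" for x y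
    using h(2) P[OF that] I[of x y] by auto
  \<comment> \<open>\<open>P\<close> also contains singletons, where \<open>h\<close> is at least
    \<open>\<eta>\<close>; the diagonal is therefore set to 0 separately.\<close>
  define d where "d x y = (if x \<in> F \<and> y \<in> F \<and> x \<noteq> y then h {x, y} else 0)" for x y
  have pos: "h {x, y} > 0" if "x \<in> F" "y \<in> F" for x y
    using bounds(1)[OF that] \<eta> mdist_nonneg[of X x y] by linarith
  have d_le: "d x y \<le> mdist X x y + 2 * \<eta>" and le_d: "x \<noteq> y \<Longrightarrow> mdist X x y + \<eta> \<le> d x y"
    if "x \<in> F" "y \<in> F" for x y
    using bounds[OF that] that \<eta> by (auto simp: d_def add_nonneg_nonneg)
  interpret Metric_space F d
  proof
    show "0 \<le> d x y" for x y
      using pos by (simp add: d_def less_imp_le)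
    show "d x y = d y x" for x y
      by (auto simp: d_def insert_commute)
    show "d x y = 0 \<longleftrightarrow> x = y" if "x \<in> F" "y \<in> F" for x y
      using pos[OF that] that by (auto simp: d_def)
    show "d x z \<le> d x y + d y z" if "x \<in> F" "y \<in> F" "z \<in> F" for x y z
    \<comment> \<open>The lower bound \<open>le_d\<close> holds only off the diagonal, so degenerate
      triangles are split off; \<open>d_le\<close> still covers \<open>x = z\<close>.\<close>
    proof (cases "x = y \<or> y = z")
      case True
      then show ?thesis
        by (auto simp: d_def)
    next
      case False
      have "mdist X x z \<le> mdist X x y + mdist X y z"
        using that F(2) by (intro mdist_triangle) auto
      then show ?thesis
        using False d_le[of x z] le_d[of x y] le_d[of y z] that by auto
    qed
  qed
  show thesis
  proof (rule that[of "metric (F, d)"])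
    show "totally_anisometric (metric (F, d))"
      unfolding totally_anisometric_def mspace_metric mdist_metric
    proof (intro ballI impI)
      fix x y x' y' assume mem: "x \<in> F" "y \<in> F" "x' \<in> F" "y' \<in> F"
        and eq: "d x y = d x' y' \<and> d x y > 0"
      then have "h {x, y} = h {x', y'}"
        by (auto simp: d_def split: if_splits)
      then show "{x, y} = {x', y'}"
        using h(1) P mem by (meson inj_onD)
    qed
    show "\<bar>mdist (metric (F, d)) x y - mdist X x y\<bar> \<le> 2 * \<eta>" if "x \<in> F" "y \<in> F" for x y
    proof (cases "x = y")
      case True
      then show ?thesis
        using subsetD[OF F(2) that(2)] \<eta> by (simp add: mdist_refl d_def)
    next
      case False
      then show ?thesis
        using d_le[OF that] le_d[OF that] \<eta> by (simp add: abs_le_iff)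
    qed
  qed simp
qed

lemma compact_metric_finite:
  assumes "finite (mspace X)" "mspace X \<noteq> {}"
  shows "compact_metric X"
  using assms by (simp add: compact_metric_def compact_space_def finite_imp_compactin)

lemma finite_totally_anisometric_dense:
  fixes X :: "point metric"
  assumes X: "compact_metric X" and "e > 0"
  obtains Y :: "point metric" where "compact_metric Y" "finite (mspace Y)" "totally_anisometric Y"
    "gh_distance X Y < e"
proof -
  interpret Metric_space "mspace X" "mdist X" by blast
  \<comment> \<open>Moving to an \<open>\<eta>\<close>-net changes distances by at most
    \<open>2 * \<eta>\<close>, and so does the perturbation. The total \<open>4 * \<eta>\<close> is
    twice the radius \<open>2 * \<eta>\<close>, which is below \<open>e\<close>.\<close>
  define \<eta> where "\<eta> = e / 3"
  have \<eta>: "\<eta> > 0"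
    using \<open>e > 0\<close> by (simp add: \<eta>_def)
  have "mtotally_bounded (mspace X)"
    using X by (simp add: compact_metric_def mtopology_of_def compact_space_eq_mcomplete_mtotally_bounded)
  then obtain F where F: "finite F" "F \<subseteq> mspace X" "mspace X \<subseteq> (\<Union>x\<in>F. mball x \<eta>)"
    using \<eta> unfolding mtotally_bounded_def by meson
  have "F \<noteq> {}"
    using F(3) X by (auto simp: compact_metric_def)
  obtain Y :: "point metric" where Y: "mspace Y = F" "totally_anisometric Y"
    "\<And>x y. x \<in> F \<Longrightarrow> y \<in> F \<Longrightarrow> \<bar>mdist Y x y - mdist X x y\<bar> \<le> 2 * \<eta>"
    using totally_anisometric_perturbation[OF F(1,2) \<eta>] by metis
  have cY: "compact_metric Y"
    using Y(1) F(1) \<open>F \<noteq> {}\<close> by (simp add: compact_metric_finite)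
  have "correspondence X Y (2 * \<eta>) {(x, y) \<in> mspace X \<times> F. mdist X x y \<le> \<eta>}"
  proof (rule correspondenceI)
    show "\<exists>y. (x, y) \<in> {(x, y) \<in> mspace X \<times> F. mdist X x y \<le> \<eta>}" if "x \<in> mspace X" for x
    proof -
      have "x \<in> (\<Union>y\<in>F. mball y \<eta>)"
        using F(3) that by (rule subsetD)
      then obtain y where "y \<in> F" "mdist X y x < \<eta>"
        by auto
      then show ?thesis
        using that by (auto simp: mdist_commute intro!: exI[of _ y])
    qed
    show "\<exists>x. (x, y) \<in> {(x, y) \<in> mspace X \<times> F. mdist X x y \<le> \<eta>}" if "y \<in> mspace Y" for y
      using that Y(1) F(2) \<eta> by (auto intro!: exI[of _ y])
    fix x y x' y'
    assume "(x, y) \<in> {(x, y) \<in> mspace X \<times> F. mdist X x y \<le> \<eta>}"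
      "(x', y') \<in> {(x, y) \<in> mspace X \<times> F. mdist X x y \<le> \<eta>}"
    then have *: "x \<in> mspace X" "x' \<in> mspace X" "y \<in> F" "y' \<in> F" "mdist X x y \<le> \<eta>" "mdist X x' y' \<le> \<eta>"
      by auto
    then have "y \<in> mspace X" "y' \<in> mspace X"
      using F(2) by auto
    then have "mdist X x x' \<le> mdist X x y + mdist X y x'"
       "mdist X y x' \<le> mdist X y y' + mdist X y' x'"
       "mdist X y y' \<le> mdist X y x + mdist X x y'"
       "mdist X x y' \<le> mdist X x x' + mdist X x' y'"
      using * by (auto intro: mdist_triangle)
    moreover have "mdist X y x = mdist X x y" "mdist X y' x' = mdist X x' y'"
      by (rule mdist_commute)+
    ultimately show "\<bar>mdist X x x' - mdist Y y y'\<bar> \<le> 2 * (2 * \<eta>)"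
      using Y(3)[OF *(3,4)] *(5,6) by linarith
  qed (use Y(1) in auto)
  moreover have "0 < 2 * \<eta>" "2 * \<eta> < e"
    using \<open>e > 0\<close> by (auto simp: \<eta>_def)
  ultimately have "gh_distance X Y < e"
    unfolding gh_distance_less_iff[OF X cY] by blast
  with cY Y(1,2) F(1) show thesis
    by (intro that) auto
qed

section \<open>Passage to the Gromov-Hausdorff space\<close>

lemma abs_rep_gh_space:
  "compact_metric (rep_gh_space Q)" "abs_gh_space (rep_gh_space Q) = Q"
  using Quotient3_rep_reflp[OF Quotient3_gh_space, of Q] Quotient3_abs_rep[OF Quotient3_gh_space, of Q]
  by (simp_all add: gh_rel_def)

lemma dist_abs_gh_space:
  "compact_metric X \<Longrightarrow> compact_metric Y \<Longrightarrow> dist (abs_gh_space X) (abs_gh_space Y) = gh_distance X Y"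
  by (simp add: dist_gh_space.abs_eq gh_rel_def isometric_refl)

text \<open>A ball disjoint from \<open>S\<close> contains no point of the closure of
  \<open>S\<close>; such balls have centres arbitrarily near every point, so the closure contains no
  ball.\<close>

lemma rareI:
  fixes S :: "'a::metric_space set"
  assumes "\<And>x e. e > 0 \<Longrightarrow> \<exists>y \<delta>. dist x y < e \<and> \<delta> > 0 \<and> ball y \<delta> \<inter> S = {}"
  shows "rare S"
  unfolding rare_def
proof (rule equals0I)
  fix x assume "x \<in> interior (closure S)"
  then obtain e where e: "e > 0" "ball x e \<subseteq> closure S"
    by (auto simp: mem_interior)
  obtain y \<delta> where y: "dist x y < e" "\<delta> > 0" "ball y \<delta> \<inter> S = {}"
    using assms[OF e(1)] by blast
  then have "y \<in> closure S"
    using e(2) by auto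
  then show False
    using y(2,3) by (metis centre_in_ball open_ball open_Int_closure_eq_empty disjoint_iff)
qed

lemma rare_has_repeated_distance:
  assumes "e > 0"
  shows "rare {Q. has_repeated_distance e (rep_gh_space Q)}"
proof (rule rareI)
  fix Q :: gh_space and \<epsilon> :: real assume "\<epsilon> > 0"
  then obtain Y :: "point metric" where Y: "compact_metric Y" "finite (mspace Y)"
      "totally_anisometric Y" "gh_distance (rep_gh_space Q) Y < \<epsilon>"
    using finite_totally_anisometric_dense[OF abs_rep_gh_space(1)] by metis
  obtain \<delta> where \<delta>: "\<delta> > 0" and near: "\<And>(Z :: point metric) r R.
      \<lbrakk>r < \<delta>; correspondence Y Z r R\<rbrakk> \<Longrightarrow> \<not> has_repeated_distance e Z"
    using no_repeated_distance_near[OF Y(2,3) assms] by metis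
  have "\<not> has_repeated_distance e (rep_gh_space Q')" if "Q' \<in> ball (abs_gh_space Y) \<delta>" for Q'
  proof -
    have "gh_distance Y (rep_gh_space Q') < \<delta>"
      using that dist_abs_gh_space[OF Y(1) abs_rep_gh_space(1)[of Q']] by (simp add: abs_rep_gh_space)
    then show ?thesis
      \<comment> \<open>A distance below \<open>\<delta>\<close> yields a correspondence of radius
        below \<open>\<delta>\<close>, to which \<open>near\<close> applies.\<close>
      using near unfolding gh_distance_less_iff[OF Y(1) abs_rep_gh_space(1)] by blast
  qed
  then have "ball (abs_gh_space Y) \<delta> \<inter> {Q. has_repeated_distance e (rep_gh_space Q)} = {}"
    by blast
  moreover have "dist Q (abs_gh_space Y) < \<epsilon>"
    using Y(4) dist_abs_gh_space[OF abs_rep_gh_space(1)[of Q] Y(1)] by (simp add: abs_rep_gh_space)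
  ultimately show "\<exists>P \<delta>. dist Q P < \<epsilon> \<and> \<delta> > 0 \<and>
      ball P \<delta> \<inter> {Q. has_repeated_distance e (rep_gh_space Q)} = {}"
    using \<delta> by blast
qed

theorem theorem2:
  shows "residual {X :: gh_space. gh_totally_anisometric X}"
proof -
  let ?B = "\<lambda>n. {Q. has_repeated_distance (1 / real (Suc n)) (rep_gh_space Q)}"
  \<comment> \<open>The lifted predicate is read off on the representative chosen by
    \<open>rep_gh_space\<close>, the same one that \<open>?B\<close> tests.\<close>
  have "- {X. gh_totally_anisometric X} = \<Union> (range ?B)"
    using not_totally_anisometric_iff by (auto simp: gh_totally_anisometric.rep_eq)
  moreover have "\<forall>A\<in>range ?B. rare A"
    by (auto intro: rare_has_repeated_distance)
  ultimately show ?thesis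
    unfolding residual_def meager_def by (intro exI[of _ "range ?B"]) simp
qed

end
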